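(* Let $G$ be a group. Then $\mathrm{Core}(G)$ satisfies the identity $$w\lhd(x\lhd(y\lhd z))\ =\ y\lhd(x\lhd(w\lhd z))$$ if and only if $G$ is nilpotent of nilpotency class $\leq 2$, i.e., if and only if every commutator $[x,y]=x^{-1}y^{-1}xy$ $(x,y\in G)$ is central in $G$.
   Context: For a group $G$, $\mathrm{Core}(G)$ is the underlying set of $G$ with the binary operation $x\lhd y=xy^{-1}x$. An identity is satisfied if it holds for all values of the variables. *)

theory Defs
  imports "HOL-Algebra.Generated_Groups"
begin

record 'a binar = "'a partial_object" +
  bin_op :: "['a, 'a] \<Rightarrow> 'a" (infixl \<open>\<triangleleft>\<index>\<close> 70)

definition Core :: "('a, 'b) monoid_scheme \<Rightarrow> 'a binar" where
  "Core G = \<lparr>carrier = carrier G, bin_op = (\<lambda>x y. x \<otimes>\<^bsub>G\<^esub> inv\<^bsub>G\<^esub> y \<otimes>\<^bsub>G\<^esub> x)\<rparr>"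

definition commutator :: "('a, 'b) monoid_scheme \<Rightarrow> 'a \<Rightarrow> 'a \<Rightarrow> 'a" where
  "commutator G x y = inv\<^bsub>G\<^esub> x \<otimes>\<^bsub>G\<^esub> inv\<^bsub>G\<^esub> y \<otimes>\<^bsub>G\<^esub> x \<otimes>\<^bsub>G\<^esub> y"

definition center :: "('a, 'b) monoid_scheme \<Rightarrow> 'a set" where
  "center G = {z \<in> carrier G. \<forall>g \<in> carrier G. z \<otimes>\<^bsub>G\<^esub> g = g \<otimes>\<^bsub>G\<^esub> z}"

text \<open>The lower central series is indexed from 0, so \<open>lower_central G n\<close> is the term usually
  written \<open>\<gamma>\<close> with index \<open>n + 1\<close>, and class at most \<open>c\<close> means that \<open>lower_central G c\<close> is trivial.\<close>

primrec lower_central :: "('a, 'b) monoid_scheme \<Rightarrow> nat \<Rightarrow> 'a set" where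
  "lower_central G 0 = carrier G"
| "lower_central G (Suc n) =
     generate G {commutator G x y | x y. x \<in> lower_central G n \<and> y \<in> carrier G}"

definition nilpotent :: "('a, 'b) monoid_scheme \<Rightarrow> bool" where
  "nilpotent G \<longleftrightarrow> (\<exists>n. lower_central G n = {\<one>\<^bsub>G\<^esub>})"

text \<open>Only meaningful for nilpotent groups.\<close>

definition nilpotency_class :: "('a, 'b) monoid_scheme \<Rightarrow> nat" where
  "nilpotency_class G = (LEAST n. lower_central G n = {\<one>\<^bsub>G\<^esub>})"

end

theory Submission
  imports Defs
begin

text \<open>With \<open>u = w x\<inverse> y\<close> and \<open>v = y x\<inverse> w\<close> the identity reads \<open>u z\<inverse> v = v z\<inverse> u\<close>. If it holds, then
  \<open>z = 1\<close> shows that \<open>u\<close> and \<open>v\<close> commute, so \<open>v\<inverse> u\<close> is central; for \<open>y = 1\<close> this element is the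
  commutator of \<open>w\<close> and \<open>x\<inverse>\<close>. Conversely, \<open>u v\<inverse>\<close> is always a product of two commutators, and
  \<open>u = c v\<close> with \<open>c\<close> central gives the identity.\<close>

context group
begin

text \<open>Once \<open>m_assoc\<close> has nested a product to the right, a factor meets its
  inverse in this shape. With this rule and the next one, \<open>simp\<close> decides the word
  identities below.\<close>

lemma inv_mult_cancel_left [simp]:
  "\<lbrakk>x \<in> carrier G; y \<in> carrier G\<rbrakk> \<Longrightarrow> inv x \<otimes> (x \<otimes> y) = y"
  by (simp flip: m_assoc)

lemma mult_inv_cancel_left [simp]:
  "\<lbrakk>x \<in> carrier G; y \<in> carrier G\<rbrakk> \<Longrightarrow> x \<otimes> (inv x \<otimes> y) = y"
  by (simp flip: m_assoc)

lemma commutator_closed [simp]: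
  "\<lbrakk>x \<in> carrier G; y \<in> carrier G\<rbrakk> \<Longrightarrow> commutator G x y \<in> carrier G"
  by (simp add: commutator_def)

lemma commutator_eq_one_iff:
  assumes "x \<in> carrier G" "y \<in> carrier G"
  shows "commutator G x y = \<one> \<longleftrightarrow> x \<otimes> y = y \<otimes> x"
proof -
  have "commutator G x y = inv (y \<otimes> x) \<otimes> (x \<otimes> y)"
    using assms by (simp add: commutator_def inv_mult_group m_assoc)
  then show ?thesis
    using assms inv_solve_left'[of \<one> "y \<otimes> x" "x \<otimes> y"] by simp
qed

lemma center_subgroup: "subgroup (center G) G"
proof (rule subgroupI)
  show "center G \<noteq> {}"
    by (auto simp: center_def intro!: exI[of _ \<one>])
next
  fix z assume z: "z \<in> center G"
  have "inv z \<otimes> g = g \<otimes> inv z" if "g \<in> carrier G" for g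
  proof -
    have zg: "z \<otimes> g = g \<otimes> z" and [simp]: "z \<in> carrier G" "g \<in> carrier G"
      using z that by (simp_all add: center_def)
    \<comment> \<open>Inserting \<open>z \<otimes> inv z\<close> after \<open>g\<close> makes room
      for \<open>zg\<close>.\<close>
    have "inv z \<otimes> g = inv z \<otimes> (g \<otimes> z) \<otimes> inv z"
      by (simp add: m_assoc)
    also have "\<dots> = inv z \<otimes> (z \<otimes> g) \<otimes> inv z"
      by (simp only: zg)
    also have "\<dots> = g \<otimes> inv z"
      by simp
    finally show ?thesis .
  qed
  with z show "inv z \<in> center G"
    by (simp add: center_def)
next
  fix y z assume "y \<in> center G" "z \<in> center G"
  then have closed: "y \<in> carrier G" "z \<in> carrier G"
    and comm: "\<And>g. g \<in> carrier G \<Longrightarrow> y \<otimes> g = g \<otimes> y" "\<And>g. g \<in> carrier G \<Longrightarrow> z \<otimes> g = g \<otimes> z"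
    unfolding center_def by blast+
  have "y \<otimes> z \<otimes> g = g \<otimes> (y \<otimes> z)" if "g \<in> carrier G" for g
    using closed that by (metis comm m_assoc)
  then show "y \<otimes> z \<in> center G"
    using closed unfolding center_def by blast
qed (auto simp: center_def)

lemma lower_central_subset: "lower_central G n \<subseteq> carrier G"
proof (induction n)
  case (Suc n)
  then show ?case
    by (auto intro!: generate_incl)
qed simp

lemma generate_eq_one_iff: "generate G S = {\<one>} \<longleftrightarrow> S \<subseteq> {\<one>}"
proof
  assume "S \<subseteq> {\<one>}"
  then have "generate G S \<subseteq> generate G {\<one>}"
    by (rule mono_generate)
  then show "generate G S = {\<one>}"
    using generate.one[of G S] by (auto simp: generate_one)
qed (auto intro: generate.incl)

text \<open>A generated subgroup is trivial iff its generators are, and a commutator is trivial iff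
  its two entries commute.\<close>

lemma lower_central_Suc_eq_one_iff:
  "lower_central G (Suc n) = {\<one>} \<longleftrightarrow> lower_central G n \<subseteq> center G"
  unfolding lower_central.simps generate_eq_one_iff
  using lower_central_subset[of n]
  by (fastforce simp: center_def commutator_eq_one_iff subset_iff)

text \<open>The trivial subgroup is central, so the series stays trivial once it is. This carries
  triviality from the least index up to any bound on the class.\<close>

lemma lower_central_one_mono:
  assumes "lower_central G m = {\<one>}" "m \<le> n"
  shows "lower_central G n = {\<one>}"
  using assms(2,1)
proof (induction n rule: dec_induct)
  case (step n)
  then show ?case
    unfolding lower_central_Suc_eq_one_iff
    using subgroup.one_closed[OF center_subgroup] by simp
qed

lemma nilpotency_class_le_iff:
  "nilpotent G \<and> nilpotency_class G \<le> n \<longleftrightarrow> lower_central G n = {\<one>}"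
proof
  assume "nilpotent G \<and> nilpotency_class G \<le> n"
  then show "lower_central G n = {\<one>}"
    unfolding nilpotent_def nilpotency_class_def
    by (metis (mono_tags, lifting) LeastI_ex lower_central_one_mono)
next
  assume "lower_central G n = {\<one>}"
  then show "nilpotent G \<and> nilpotency_class G \<le> n"
    unfolding nilpotent_def nilpotency_class_def by (auto intro: Least_le)
qed

lemma lower_central_2_eq_one_iff:
  "lower_central G 2 = {\<one>} \<longleftrightarrow>
    (\<forall>x \<in> carrier G. \<forall>y \<in> carrier G. commutator G x y \<in> center G)"
proof -
  let ?S = "{commutator G x y | x y. x \<in> carrier G \<and> y \<in> carrier G}"
  have "lower_central G 2 = {\<one>} \<longleftrightarrow> generate G ?S \<subseteq> center G"
    \<comment> \<open>The term with index 1 is the derived subgroup, generated by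
      \<open>?S\<close>.\<close>
    using lower_central_Suc_eq_one_iff[of 1] by (simp add: numeral_2_eq_2)
  also have "\<dots> \<longleftrightarrow> ?S \<subseteq> center G"
    using generate_subgroup_incl[OF _ center_subgroup] generate.incl[of _ ?S G] by blast
  finally show ?thesis
    by blast
qed

text \<open>The inner value is
  \<open>x \<otimes> inv y \<otimes> z \<otimes> inv y \<otimes> x\<close>, and the outer operation
  inverts it once more. In this form, exchanging \<open>w\<close> and \<open>y\<close> just
  exchanges the two outer factors.\<close>

lemma Core_triple:
  assumes "w \<in> carrier G" "x \<in> carrier G" "y \<in> carrier G" "z \<in> carrier G"
  shows "w \<triangleleft>\<^bsub>Core G\<^esub> (x \<triangleleft>\<^bsub>Core G\<^esub> (y \<triangleleft>\<^bsub>Core G\<^esub> z)) =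
    (w \<otimes> inv x \<otimes> y) \<otimes> inv z \<otimes> (y \<otimes> inv x \<otimes> w)"
  using assms by (simp add: Core_def inv_mult_group m_assoc)

lemma swap_identity_imp_center:
  assumes "u \<in> carrier G" "v \<in> carrier G"
    and swap: "\<And>z. z \<in> carrier G \<Longrightarrow> u \<otimes> inv z \<otimes> v = v \<otimes> inv z \<otimes> u"
  shows "inv v \<otimes> u \<in> center G"
proof -
  have "u \<otimes> v = v \<otimes> u"
    using swap[of \<one>] assms by simp
  then have comm: "u \<otimes> inv v = inv v \<otimes> u"
    by (metis assms(1,2) inv_closed inv_solve_left inv_solve_right m_assoc m_closed)
  have "inv v \<otimes> u \<otimes> g = g \<otimes> (inv v \<otimes> u)" if g: "g \<in> carrier G" for g
  proof -
    have "u \<otimes> g \<otimes> v = v \<otimes> g \<otimes> u"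
      \<comment> \<open>Taking \<open>inv g\<close> for \<open>z\<close> leaves \<open>g\<close>
        itself in the middle.\<close>
      using swap[of "inv g"] g by simp
    then have "inv v \<otimes> (u \<otimes> g \<otimes> v) \<otimes> inv v = inv v \<otimes> (v \<otimes> g \<otimes> u) \<otimes> inv v"
      by simp
    then have "inv v \<otimes> u \<otimes> g = g \<otimes> (u \<otimes> inv v)"
      using assms g by (simp add: m_assoc)
    then show ?thesis
      by (simp add: comm)
  qed
  then show ?thesis
    using assms by (simp add: center_def)
qed

text \<open>In \<open>c \<otimes> v \<otimes> z \<otimes> v\<close> the central \<open>c\<close>
  moves past \<open>v \<otimes> z\<close> and rebuilds \<open>u\<close> on the right.\<close>

lemma center_imp_swap_identity:
  assumes "u \<in> carrier G" "v \<in> carrier G" "z \<in> carrier G" and c: "u \<otimes> inv v \<in> center G"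
  shows "u \<otimes> z \<otimes> v = v \<otimes> z \<otimes> u"
proof -
  define c where "c = u \<otimes> inv v"
  have u: "u = c \<otimes> v"
    using assms by (simp add: c_def m_assoc)
  have closed: "c \<in> carrier G"
    using assms by (simp add: c_def)
  have "c \<otimes> (v \<otimes> z) = (v \<otimes> z) \<otimes> c"
    using c assms(1-3) by (simp add: center_def c_def)
  then show ?thesis
    unfolding u using closed assms(2,3) by (metis m_assoc m_closed)
qed

lemma Core_identity_iff:
  "(\<forall>w \<in> carrier G. \<forall>x \<in> carrier G. \<forall>y \<in> carrier G. \<forall>z \<in> carrier G.
      w \<triangleleft>\<^bsub>Core G\<^esub> (x \<triangleleft>\<^bsub>Core G\<^esub> (y \<triangleleft>\<^bsub>Core G\<^esub> z)) =
      y \<triangleleft>\<^bsub>Core G\<^esub> (x \<triangleleft>\<^bsub>Core G\<^esub> (w \<triangleleft>\<^bsub>Core G\<^esub> z))) \<longleftrightarrow>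
   (\<forall>x \<in> carrier G. \<forall>y \<in> carrier G. commutator G x y \<in> center G)"
  (is "?L \<longleftrightarrow> ?R")
proof
  assume L: ?L
  show ?R
  proof (intro ballI)
    fix x y assume xy: "x \<in> carrier G" "y \<in> carrier G"
    have "x \<otimes> y \<otimes> inv z \<otimes> (y \<otimes> x) = y \<otimes> x \<otimes> inv z \<otimes> (x \<otimes> y)" if "z \<in> carrier G" for z
      \<comment> \<open>With these values the outer factors become \<open>x \<otimes> y\<close> and
        \<open>y \<otimes> x\<close>, whose quotient is the commutator.\<close>
      using L[rule_format, of x "inv y" \<one> z] xy that by (simp add: Core_triple)
    then have "inv (y \<otimes> x) \<otimes> (x \<otimes> y) \<in> center G"
      using xy by (intro swap_identity_imp_center) auto
    then show "commutator G x y \<in> center G"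
      using xy by (simp add: commutator_def inv_mult_group m_assoc)
  qed
next
  assume R: ?R
  show ?L
  proof (intro ballI)
    fix w x y z
    assume [simp]: "w \<in> carrier G" "x \<in> carrier G" "y \<in> carrier G" "z \<in> carrier G"
    \<comment> \<open>For \<open>t = inv x \<otimes> y\<close> the first commutator is
      \<open>w \<otimes> t \<otimes> inv w \<otimes> inv t\<close>; the second turns the trailing
      \<open>inv t = inv y \<otimes> x\<close> into \<open>x \<otimes> inv y\<close>.\<close>
    have "(w \<otimes> inv x \<otimes> y) \<otimes> inv (y \<otimes> inv x \<otimes> w) =
        commutator G (inv w) (inv y \<otimes> x) \<otimes> commutator G x (inv y)"
      by (simp add: commutator_def inv_mult_group m_assoc)
    also have "\<dots> \<in> center G"
      using R by (intro subgroup.m_closed[OF center_subgroup]) auto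
    finally have "(w \<otimes> inv x \<otimes> y) \<otimes> inv z \<otimes> (y \<otimes> inv x \<otimes> w) =
        (y \<otimes> inv x \<otimes> w) \<otimes> inv z \<otimes> (w \<otimes> inv x \<otimes> y)"
      \<comment> \<open>\<open>rotated 3\<close> puts the centrality premise first, to meet the
        chained fact; \<open>inv z\<close> takes the place of the lemma's \<open>z\<close>.\<close>
      by (rule center_imp_swap_identity[rotated 3]) simp_all
    then show "w \<triangleleft>\<^bsub>Core G\<^esub> (x \<triangleleft>\<^bsub>Core G\<^esub> (y \<triangleleft>\<^bsub>Core G\<^esub> z)) =
        y \<triangleleft>\<^bsub>Core G\<^esub> (x \<triangleleft>\<^bsub>Core G\<^esub> (w \<triangleleft>\<^bsub>Core G\<^esub> z))"
      by (simp add: Core_triple)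
  qed
qed

end

theorem theorem7p2:
  fixes G :: "('a, 'b) monoid_scheme"
  assumes "group G"
  shows "((\<forall>w \<in> carrier (Core G). \<forall>x \<in> carrier (Core G).
           \<forall>y \<in> carrier (Core G). \<forall>z \<in> carrier (Core G).
             w \<triangleleft>\<^bsub>Core G\<^esub> (x \<triangleleft>\<^bsub>Core G\<^esub> (y \<triangleleft>\<^bsub>Core G\<^esub> z)) =
             y \<triangleleft>\<^bsub>Core G\<^esub> (x \<triangleleft>\<^bsub>Core G\<^esub> (w \<triangleleft>\<^bsub>Core G\<^esub> z)))
          \<longleftrightarrow> nilpotent G \<and> nilpotency_class G \<le> 2)
       \<and> (nilpotent G \<and> nilpotency_class G \<le> 2
          \<longleftrightarrow> (\<forall>x \<in> carrier G. \<forall>y \<in> carrier G. commutator G x y \<in> center G))"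
proof -
  have carrier: "carrier (Core G) = carrier G"
    by (simp add: Core_def)
  show ?thesis
    unfolding carrier group.nilpotency_class_le_iff[OF assms]
      group.lower_central_2_eq_one_iff[OF assms] group.Core_identity_iff[OF assms]
    by simp
qed

end
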